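(* Let $\Omega\subset\mathbb{C}^2$ be a smoothly bounded, pseudoconvex domain, $p_0\in b\Omega$. Then $\Omega$ admits a smooth local defining function near $p_0$ which is plurisubharmonic on $b\Omega$ near $p_0$ if and only if there exist an open neighborhood $U$ of $p_0$ and a smooth local defining function $\rho$ for $\Omega$ on $U$ such that $$|H_\rho(L,N)|^2=\mathcal{O}(H_\rho(L,L))\quad\text{on } b\Omega\cap U. \qquad ( * )$$ In fact, $( * )$ holds true for every smooth local defining function $\rho\colon U\to\mathbb{R}$ that is plurisubharmonic on $b\Omega\cap U$.
   Context: "Smooth" means $\mathcal{C}^\infty$; "smoothly bounded" means that $b\Omega$ is smooth. A smooth function $r\colon U\to\mathbb{R}$ is a local defining function for $\Omega$ near $p_0\in b\Omega$ if $U$ is an open neighborhood of $p_0$, $\Omega\cap U=\{r<0\}$, and $dr\ne0$ on $b\Omega\cap U$. Coordinates are $(z,w)=(z^1,z^2)$. For $(1,0)$ vector fields, $H_f(A,B)=\sum_{j,k}\frac{\partial^2f}{\partial z^j\partial\bar z^k}A^j\overline{B^k}$. $\Omega$ is pseudoconvex if $H_r(A,A)\ge0$ on $b\Omega$ for every local defining function $r$ and every smooth $(1,0)$ vector field $A$ with $Ar=0$ on $b\Omega$. A function $\rho\colon U\to\mathbb{R}$ is plurisubharmonic on $b\Omega\cap U$ if $H_\rho(V,V)\ge0$ at every point of $b\Omega\cap U$ for every smooth $(1,0)$ vector field $V$ on $U$ (all directions, only at boundary points); "plurisubharmonic on $b\Omega$ near $p_0$" means this for some open neighborhood $U$ of $p_0$.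 Canonical vector fields: for a smooth local defining function $r$, near $b\Omega\cap U$ set $$L=L_r=\frac{1}{\sqrt{|r_z|^2+|r_w|^2}}\Big(r_w\frac{\partial}{\partial z}-r_z\frac{\partial}{\partial w}\Big),\qquad N=N_r=\frac{1}{\sqrt{|r_z|^2+|r_w|^2}}\Big(r_{\bar z}\frac{\partial}{\partial z}+r_{\bar w}\frac{\partial}{\partial w}\Big).$$ On $b\Omega$ these do not depend on $r$. For functions $f,g$ on $b\Omega\cap U$, "$f=\mathcal{O}(g)$ on $b\Omega\cap U$" means: for every $K\Subset b\Omega\cap U$ there is $C>0$ with $|f|\le C|g|$ on $K$. *)

theory Defs
  imports "HOL-Analysis.Analysis"
begin

text \<open>A function on an open set \<open>U\<close> is represented by a total function of which only the values
  on \<open>U\<close> matter; all derivatives below are taken at points of an open \<open>U\<close>.\<close>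

text \<open>\<open>C\<^sup>n\<close> on an open subset of a finite-dimensional space, in the real sense:
  all iterated directional derivatives up to order \<open>n\<close> exist and are continuous.\<close>

primrec C_n_on :: "nat \<Rightarrow> 'a::euclidean_space set \<Rightarrow> ('a \<Rightarrow> 'b::real_normed_vector) \<Rightarrow> bool" where
  "C_n_on 0 U f \<longleftrightarrow> continuous_on U f"
| "C_n_on (Suc n) U f \<longleftrightarrow>
     (\<forall>x\<in>U. f differentiable (at x)) \<and>
     (\<forall>v. C_n_on n U (\<lambda>x. frechet_derivative f (at x) v))"

definition smooth_on :: "'a::euclidean_space set \<Rightarrow> ('a \<Rightarrow> 'b::real_normed_vector) \<Rightarrow> bool" where
  "smooth_on U f \<longleftrightarrow> (\<forall>n. C_n_on n U f)"

text \<open>Wirtinger derivatives: with \<open>z\<^sup>j = x\<^sup>j + i y\<^sup>j\<close>, the real directions \<open>x\<^sup>j\<close> and \<open>y\<^sup>j\<close> are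
  \<^term>\<open>axis j 1\<close> and \<^term>\<open>axis j \<i>\<close>.\<close>

definition d_z :: "2 \<Rightarrow> (complex^2 \<Rightarrow> complex) \<Rightarrow> complex^2 \<Rightarrow> complex" where
  "d_z j f p = (frechet_derivative f (at p) (axis j 1)
                - \<i> * frechet_derivative f (at p) (axis j \<i>)) / 2"

definition d_zbar :: "2 \<Rightarrow> (complex^2 \<Rightarrow> complex) \<Rightarrow> complex^2 \<Rightarrow> complex" where
  "d_zbar j f p = (frechet_derivative f (at p) (axis j 1)
                   + \<i> * frechet_derivative f (at p) (axis j \<i>)) / 2"

abbreviation cplx :: "('a \<Rightarrow> real) \<Rightarrow> 'a \<Rightarrow> complex" where
  "cplx r \<equiv> (\<lambda>x. complex_of_real (r x))"

text \<open>The (1,0) vector field \<open>A\<^sup>1 \<partial>/\<partial>z + A\<^sup>2 \<partial>/\<partial>w\<close> is represented by its coefficient map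
  \<open>p \<mapsto> (A\<^sup>1(p), A\<^sup>2(p))\<close>.\<close>

type_synonym vfield10 = "complex^2 \<Rightarrow> complex^2"

definition vf_apply :: "vfield10 \<Rightarrow> (complex^2 \<Rightarrow> real) \<Rightarrow> complex^2 \<Rightarrow> complex" where
  "vf_apply A r p = (\<Sum>j\<in>UNIV. A p $ j * d_z j (cplx r) p)"

definition complex_hessian ::
  "(complex^2 \<Rightarrow> real) \<Rightarrow> vfield10 \<Rightarrow> vfield10 \<Rightarrow> complex^2 \<Rightarrow> complex" where
  "complex_hessian f A B p =
     (\<Sum>j\<in>UNIV. \<Sum>k\<in>UNIV. d_z j (d_zbar k (cplx f)) p * (A p $ j) * cnj (B p $ k))"

text \<open>The condition \<open>r = 0\<close> on \<open>b\<Omega> \<inter> U\<close> follows when \<open>\<Omega>\<close> is open.\<close>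

definition local_defining_function ::
  "(complex^2) set \<Rightarrow> complex^2 \<Rightarrow> (complex^2) set \<Rightarrow> (complex^2 \<Rightarrow> real) \<Rightarrow> bool" where
  "local_defining_function \<Omega> p\<^sub>0 U r \<longleftrightarrow>
     p\<^sub>0 \<in> frontier \<Omega> \<and> open U \<and> p\<^sub>0 \<in> U \<and> smooth_on U r \<and>
     \<Omega> \<inter> U = {p \<in> U. r p < 0} \<and>
     (\<forall>p \<in> frontier \<Omega> \<inter> U. frechet_derivative r (at p) \<noteq> (\<lambda>v. 0))"

text \<open>Smoothness of the boundary alone; boundedness of \<open>\<Omega>\<close> is not part of the notion.\<close>

definition smoothly_bounded :: "(complex^2) set \<Rightarrow> bool" where
  "smoothly_bounded \<Omega> \<longleftrightarrow> (\<forall>p \<in> frontier \<Omega>. \<exists>U r. local_defining_function \<Omega> p U r)"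

text \<open>Membership in \<open>\<real>\<^sub>\<ge>\<^sub>0\<close> renders \<open>H(A,A) \<ge> 0\<close>, the value being a real number by symmetry of
  second derivatives.\<close>

definition pseudoconvex :: "(complex^2) set \<Rightarrow> bool" where
  "pseudoconvex \<Omega> \<longleftrightarrow>
     (\<forall>q U r A. local_defining_function \<Omega> q U r \<longrightarrow> smooth_on U A \<longrightarrow>
        (\<forall>p \<in> frontier \<Omega> \<inter> U. vf_apply A r p = 0) \<longrightarrow>
        (\<forall>p \<in> frontier \<Omega> \<inter> U. complex_hessian r A A p \<in> \<real>\<^sub>\<ge>\<^sub>0))"

definition psh_on_boundary ::
  "(complex^2) set \<Rightarrow> (complex^2) set \<Rightarrow> (complex^2 \<Rightarrow> real) \<Rightarrow> bool" where
  "psh_on_boundary \<Omega> U \<rho> \<longleftrightarrow>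
     (\<forall>V. smooth_on U V \<longrightarrow> (\<forall>p \<in> frontier \<Omega> \<inter> U. complex_hessian \<rho> V V p \<in> \<real>\<^sub>\<ge>\<^sub>0))"

text \<open>Here \<open>U\<close> is the domain of \<open>\<rho>\<close>.\<close>

definition psh_on_boundary_near ::
  "(complex^2) set \<Rightarrow> complex^2 \<Rightarrow> (complex^2) set \<Rightarrow> (complex^2 \<Rightarrow> real) \<Rightarrow> bool" where
  "psh_on_boundary_near \<Omega> p\<^sub>0 U \<rho> \<longleftrightarrow>
     (\<exists>W. open W \<and> p\<^sub>0 \<in> W \<and> W \<subseteq> U \<and> psh_on_boundary \<Omega> W \<rho>)"

definition grad_norm :: "(complex^2 \<Rightarrow> real) \<Rightarrow> complex^2 \<Rightarrow> real" where
  "grad_norm r p = sqrt ((cmod (d_z 1 (cplx r) p))\<^sup>2 + (cmod (d_z 2 (cplx r) p))\<^sup>2)"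

definition L_field :: "(complex^2 \<Rightarrow> real) \<Rightarrow> vfield10" where
  "L_field r p =
     (1 / grad_norm r p) *\<^sub>R vector [d_z 2 (cplx r) p, - d_z 1 (cplx r) p]"

definition N_field :: "(complex^2 \<Rightarrow> real) \<Rightarrow> vfield10" where
  "N_field r p =
     (1 / grad_norm r p) *\<^sub>R vector [d_zbar 1 (cplx r) p, d_zbar 2 (cplx r) p]"

text \<open>\<open>K\<close> ranges over the relatively compact subsets of \<open>S\<close>.\<close>

definition bigO_loc ::
  "'a::topological_space set \<Rightarrow> ('a \<Rightarrow> 'b::real_normed_vector) \<Rightarrow> ('a \<Rightarrow> 'c::real_normed_vector) \<Rightarrow> bool"
where
  "bigO_loc S f g \<longleftrightarrow>
     (\<forall>K. compact (closure K) \<and> closure K \<subseteq> S \<longrightarrow>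
        (\<exists>C>0. \<forall>x\<in>K. norm (f x) \<le> C * norm (g x)))"

definition hessian_estimate ::
  "(complex^2) set \<Rightarrow> (complex^2) set \<Rightarrow> (complex^2 \<Rightarrow> real) \<Rightarrow> bool" where
  "hessian_estimate \<Omega> U \<rho> \<longleftrightarrow>
     bigO_loc (frontier \<Omega> \<inter> U)
       (\<lambda>p. (cmod (complex_hessian \<rho> (L_field \<rho>) (N_field \<rho>) p))\<^sup>2)
       (complex_hessian \<rho> (L_field \<rho>) (L_field \<rho>))"

end

theory Submission
  imports Defs
begin

text \<open>If \<open>H\<^sub>\<rho>\<close> is positive semidefinite at boundary points, the estimate is the Cauchy--Schwarz
  inequality together with the boundedness of \<open>H\<^sub>\<rho>(N,N)\<close> on compact sets. Conversely, for
  \<open>r = \<rho> + M \<rho>\<^sup>2\<close> one has \<open>H\<^sub>r(V,V) = H\<^sub>\<rho>(V,V) + 2 M \<bar>V \<rho>\<bar>\<^sup>2\<close> on the boundary. For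
  \<open>V = a L + b N\<close> the extra term is \<open>2 M g\<^sup>2 \<bar>b\<bar>\<^sup>2\<close> with \<open>g = N \<rho> > 0\<close>, since \<open>L \<rho> = 0\<close>. As
  \<open>H\<^sub>\<rho>(L,L) \<ge> 0\<close> by pseudoconvexity, the estimate \<open>\<bar>H\<^sub>\<rho>(L,N)\<bar>\<^sup>2 \<le> C H\<^sub>\<rho>(L,L)\<close> makes
  \<open>\<bar>a\<bar>\<^sup>2 H\<^sub>\<rho>(L,L) + 2 Re (a b\<^sup>* H\<^sub>\<rho>(L,N)) + C \<bar>b\<bar>\<^sup>2\<close> nonnegative, where \<open>b\<^sup>*\<close> is the conjugate
  of \<open>b\<close>, so it suffices that \<open>2 M g\<^sup>2 + H\<^sub>\<rho>(N,N) \<ge> C\<close> near \<open>p\<^sub>0\<close>.\<close>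

section \<open>Functions of class \<open>C\<^sup>n\<close>\<close>

lemma C_n_on_subset: "C_n_on n U f \<Longrightarrow> W \<subseteq> U \<Longrightarrow> C_n_on n W f"
  by (induction n arbitrary: f) (auto intro: continuous_on_subset)

text \<open>On an open set the derivative at a point depends only on nearby values, so the values of
  a representative off \<open>U\<close> never matter.\<close>

lemma C_n_on_cong:
  assumes "open U" and "\<And>x. x \<in> U \<Longrightarrow> f x = g x" and "C_n_on n U f"
  shows "C_n_on n U g"
  using assms(2,3)
proof (induction n arbitrary: f g)
  case 0
  then show ?case using continuous_on_eq by auto
next
  case (Suc n)
  have diff: "f differentiable (at x)" if "x \<in> U" for x using Suc.prems that by simp
  have fd: "frechet_derivative f (at x) = frechet_derivative g (at x)" if "x \<in> U" for x
    by (rule frechet_derivative_transform_within_open[OF diff \<open>open U\<close>]) (use that Suc.prems in auto)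
  have "g differentiable (at x)" if "x \<in> U" for x
    using diff[OF that] has_derivative_transform_within_open[OF _ \<open>open U\<close> that] Suc.prems(1)
    by (meson differentiable_def)
  moreover have "C_n_on n U (\<lambda>x. frechet_derivative g (at x) v)" for v
    by (rule Suc.IH[where f = "\<lambda>x. frechet_derivative f (at x) v"]) (use fd Suc.prems in auto)
  ultimately show ?case by simp
qed

lemma C_n_on_SucD: "C_n_on (Suc n) U f \<Longrightarrow> C_n_on n U f"
proof (induction n arbitrary: f)
  case 0
  then show ?case
    by (simp add: continuous_at_imp_continuous_on differentiable_imp_continuous_within)
next
  case (Suc n)
  have "C_n_on n U (\<lambda>x. frechet_derivative f (at x) v)" for v
    by (rule Suc.IH) (use Suc.prems in simp)
  then show ?case using Suc.prems by simp
qed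

text \<open>Lets an explicit derivative \<open>F\<close> stand in for
  \<open>frechet_derivative\<close>, so that the inductions below can run on the formulas of the
  differentiation rules.\<close>

lemma C_n_on_SucI:
  assumes "open U" and "\<And>x. x \<in> U \<Longrightarrow> (f has_derivative F x) (at x)"
    and "\<And>v. C_n_on n U (\<lambda>x. F x v)"
  shows "C_n_on (Suc n) U f"
proof -
  have "frechet_derivative f (at x) = F x" if "x \<in> U" for x
    using frechet_derivative_at assms(2)[OF that] by metis
  then have "C_n_on n U (\<lambda>x. frechet_derivative f (at x) v)" for v
    by (intro C_n_on_cong[OF assms(1) _ assms(3)]) simp
  moreover have "f differentiable (at x)" if "x \<in> U" for x
    using assms(2)[OF that] by (rule differentiableI)
  ultimately show ?thesis by simp
qed

lemma C_n_on_Suc_derivative: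
  assumes "C_n_on (Suc n) U f" and "x \<in> U"
  shows "(f has_derivative frechet_derivative f (at x)) (at x)"
  using assms frechet_derivative_works by auto

lemma C_n_on_const: "C_n_on n U (\<lambda>x. c)"
  by (induction n arbitrary: c) auto

lemma C_n_on_bounded_linear:
  assumes "open U" and "bounded_linear h" and "C_n_on n U f"
  shows "C_n_on n U (\<lambda>x. h (f x))"
  using assms(3)
proof (induction n arbitrary: f)
  case 0
  then show ?case using bounded_linear.continuous_on[OF assms(2)] by auto
next
  case (Suc n)
  show ?case
  proof (rule C_n_on_SucI[OF assms(1)])
    show "((\<lambda>x. h (f x)) has_derivative (\<lambda>v. h (frechet_derivative f (at x) v))) (at x)"
      if "x \<in> U" for x
      by (rule bounded_linear.has_derivative[OF assms(2) C_n_on_Suc_derivative[OF Suc.prems that]])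
    show "C_n_on n U (\<lambda>x. h (frechet_derivative f (at x) v))" for v
      by (rule Suc.IH) (use Suc.prems in simp)
  qed
qed

lemma C_n_on_add:
  assumes "open U" and "C_n_on n U f" and "C_n_on n U g"
  shows "C_n_on n U (\<lambda>x. f x + g x)"
  using assms(2,3)
proof (induction n arbitrary: f g)
  case 0
  then show ?case by (auto intro: continuous_intros)
next
  case (Suc n)
  show ?case
  proof (rule C_n_on_SucI[OF assms(1)])
    show "((\<lambda>x. f x + g x) has_derivative
        (\<lambda>v. frechet_derivative f (at x) v + frechet_derivative g (at x) v)) (at x)"
      if "x \<in> U" for x
      using Suc.prems that by (intro has_derivative_add C_n_on_Suc_derivative)
    show "C_n_on n U (\<lambda>x. frechet_derivative f (at x) v + frechet_derivative g (at x) v)" for v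
      by (rule Suc.IH) (use Suc.prems in simp_all)
  qed
qed

lemma C_n_on_bounded_bilinear:
  assumes "open U" and "bounded_bilinear b" and "C_n_on n U f" and "C_n_on n U g"
  shows "C_n_on n U (\<lambda>x. b (f x) (g x))"
  using assms(3,4)
proof (induction n arbitrary: f g)
  case 0
  then show ?case using bounded_bilinear.continuous_on[OF assms(2)] by auto
next
  case (Suc n)
  show ?case
  proof (rule C_n_on_SucI[OF assms(1)])
    show "((\<lambda>x. b (f x) (g x)) has_derivative
        (\<lambda>v. b (f x) (frechet_derivative g (at x) v) + b (frechet_derivative f (at x) v) (g x))) (at x)"
      if "x \<in> U" for x
      using Suc.prems that
      by (intro bounded_bilinear.FDERIV[OF assms(2)] C_n_on_Suc_derivative)
    show "C_n_on n U (\<lambda>x. b (f x) (frechet_derivative g (at x) v)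
        + b (frechet_derivative f (at x) v) (g x))" for v
      \<comment> \<open>Each summand of the product rule pairs a derivative, of class
        \<open>n\<close>, with an undifferentiated factor, which is lowered from class
        \<open>Suc n\<close> to class \<open>n\<close>.\<close>
      using Suc.prems C_n_on_SucD[OF Suc.prems(1)] C_n_on_SucD[OF Suc.prems(2)]
      by (intro C_n_on_add[OF assms(1)] Suc.IH) simp_all
  qed
qed

section \<open>Closure properties of smooth functions\<close>

lemma smooth_onD: "smooth_on U f \<Longrightarrow> C_n_on n U f"
  by (simp add: smooth_on_def)

lemma smooth_on_subset: "smooth_on U f \<Longrightarrow> W \<subseteq> U \<Longrightarrow> smooth_on W f"
  unfolding smooth_on_def by (rule allI, rule C_n_on_subset[of _ U]) auto

lemma smooth_on_cong:
  assumes "open U" and "smooth_on U f" and "\<And>x. x \<in> U \<Longrightarrow> f x = g x"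
  shows "smooth_on U g"
  unfolding smooth_on_def
  by (rule allI, rule C_n_on_cong[OF assms(1,3) smooth_onD[OF assms(2)]])

lemma smooth_on_const: "smooth_on U (\<lambda>x. c)"
  by (simp add: smooth_on_def C_n_on_const)

lemma smooth_on_bounded_linear:
  assumes "open U" and "bounded_linear h" and "smooth_on U f"
  shows "smooth_on U (\<lambda>x. h (f x))"
  unfolding smooth_on_def
  by (rule allI, rule C_n_on_bounded_linear[OF assms(1,2) smooth_onD[OF assms(3)]])

lemma smooth_on_add:
  assumes "open U" and "smooth_on U f" and "smooth_on U g"
  shows "smooth_on U (\<lambda>x. f x + g x)"
  unfolding smooth_on_def
  by (rule allI, rule C_n_on_add[OF assms(1) smooth_onD[OF assms(2)] smooth_onD[OF assms(3)]])

lemma smooth_on_bounded_bilinear: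
  assumes "open U" and "bounded_bilinear b" and "smooth_on U f" and "smooth_on U g"
  shows "smooth_on U (\<lambda>x. b (f x) (g x))"
  unfolding smooth_on_def
  by (rule allI, rule C_n_on_bounded_bilinear[OF assms(1,2) smooth_onD[OF assms(3)] smooth_onD[OF assms(4)]])

lemma smooth_on_frechet_derivative:
  assumes "smooth_on U f"
  shows "smooth_on U (\<lambda>x. frechet_derivative f (at x) v)"
proof -
  have "C_n_on n U (\<lambda>x. frechet_derivative f (at x) v)" for n
    using smooth_onD[OF assms, of "Suc n"] by simp
  then show ?thesis by (simp add: smooth_on_def)
qed

lemma smooth_on_has_derivative:
  "smooth_on U f \<Longrightarrow> x \<in> U \<Longrightarrow> (f has_derivative frechet_derivative f (at x)) (at x)"
  by (rule C_n_on_Suc_derivative[OF smooth_onD])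

lemma smooth_on_imp_continuous_on: "smooth_on U f \<Longrightarrow> continuous_on U f"
  using smooth_onD[of U f 0] by simp

section \<open>Symmetry of second derivatives\<close>

abbreviation second_derivative ::
  "('a::real_normed_vector \<Rightarrow> 'b::real_normed_vector) \<Rightarrow> 'a \<Rightarrow> 'a \<Rightarrow> 'a \<Rightarrow> 'b" where
  "second_derivative f x u v \<equiv> frechet_derivative (\<lambda>y. frechet_derivative f (at y) v) (at x) u"

text \<open>The mean value theorem is applied twice: along \<open>u\<close> to the difference of
  \<open>f\<close> on two parallel segments, then along \<open>v\<close> to the derivative of
  \<open>f\<close> in direction \<open>u\<close>.\<close>

lemma second_difference_mean_value:
  fixes f :: "'a::euclidean_space \<Rightarrow> real"
  assumes f: "smooth_on U f" and "h > 0"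
    and U: "\<And>s t. 0 \<le> s \<Longrightarrow> s \<le> h \<Longrightarrow> 0 \<le> t \<Longrightarrow> t \<le> h \<Longrightarrow> p + s *\<^sub>R u + t *\<^sub>R v \<in> U"
  shows "\<exists>s t. 0 \<le> s \<and> s \<le> h \<and> 0 \<le> t \<and> t \<le> h \<and>
    f (p + h *\<^sub>R u + h *\<^sub>R v) - f (p + h *\<^sub>R u) - f (p + h *\<^sub>R v) + f p
      = h * h * second_derivative f (p + s *\<^sub>R u + t *\<^sub>R v) v u"
proof -
  have line: "((\<lambda>s. g (q + s *\<^sub>R w)) has_real_derivative frechet_derivative g (at (q + s *\<^sub>R w)) w) (at s)"
    if g: "smooth_on U g" and q: "q + s *\<^sub>R w \<in> U" for g :: "'a \<Rightarrow> real" and q w s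
  proof -
    have 1: "((\<lambda>s. q + s *\<^sub>R w) has_derivative (\<lambda>t. t *\<^sub>R w)) (at s)"
      by (auto intro!: derivative_eq_intros)
    have 2: "linear (frechet_derivative g (at (q + s *\<^sub>R w)))"
      using has_derivative_linear smooth_on_has_derivative[OF g q] by blast
    show ?thesis
      using diff_chain_at[OF 1 smooth_on_has_derivative[OF g q]]
      by (simp add: has_field_derivative_def o_def linear_cmul[OF 2] mult_commute_abs)
  qed
  have "((\<lambda>s. f (p + h *\<^sub>R v + s *\<^sub>R u) - f (p + s *\<^sub>R u)) has_real_derivative
      frechet_derivative f (at (p + h *\<^sub>R v + s *\<^sub>R u)) u - frechet_derivative f (at (p + s *\<^sub>R u)) u) (at s)"
    if "0 \<le> s" "s \<le> h" for s
    using U[OF that, of h] U[OF that, of 0] \<open>h > 0\<close>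
    by (intro DERIV_diff line[OF f]) (simp_all add: algebra_simps)
  from MVT2[OF \<open>h > 0\<close> this] obtain s where s: "0 < s" "s < h" and
    "f (p + h *\<^sub>R v + h *\<^sub>R u) - f (p + h *\<^sub>R u) - (f (p + h *\<^sub>R v) - f p)
      = h * (frechet_derivative f (at (p + h *\<^sub>R v + s *\<^sub>R u)) u - frechet_derivative f (at (p + s *\<^sub>R u)) u)"
    by auto
  moreover have "((\<lambda>t. frechet_derivative f (at (p + s *\<^sub>R u + t *\<^sub>R v)) u) has_real_derivative
      second_derivative f (p + s *\<^sub>R u + t *\<^sub>R v) v u) (at t)" if "0 \<le> t" "t \<le> h" for t
    using U[OF _ _ that, of s] s by (intro line[OF smooth_on_frechet_derivative[OF f]]) simp
  from MVT2[OF \<open>h > 0\<close> this] obtain t where t: "0 < t" "t < h" and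
    "frechet_derivative f (at (p + s *\<^sub>R u + h *\<^sub>R v)) u - frechet_derivative f (at (p + s *\<^sub>R u)) u
      = h * second_derivative f (p + s *\<^sub>R u + t *\<^sub>R v) v u"
    by auto
  ultimately have "f (p + h *\<^sub>R u + h *\<^sub>R v) - f (p + h *\<^sub>R u) - f (p + h *\<^sub>R v) + f p
      = h * h * second_derivative f (p + s *\<^sub>R u + t *\<^sub>R v) v u"
    by (simp add: algebra_simps)
  with s t show ?thesis by (meson less_imp_le)
qed

text \<open>The second difference is symmetric in \<open>u\<close> and \<open>v\<close>, so its two mean value expressions at
  nearby points agree.\<close>

lemma second_derivative_symmetric:
  fixes f :: "'a::euclidean_space \<Rightarrow> real"
  assumes f: "smooth_on U f" and U: "open U" "p \<in> U"
  shows "second_derivative f p u v = second_derivative f p v u"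
proof (rule ccontr)
  let ?D = "second_derivative f"
  assume "?D p u v \<noteq> ?D p v u"
  \<comment> \<open>Half the gap: two numbers, each less than \<open>e\<close> away from a different
    one of the two values, cannot be equal.\<close>
  define e where "e = \<bar>?D p u v - ?D p v u\<bar> / 2"
  have e: "e > 0" using \<open>?D p u v \<noteq> ?D p v u\<close> by (simp add: e_def)
  have "\<exists>d>0. \<forall>x. dist x p < d \<longrightarrow> \<bar>?D x a b - ?D p a b\<bar> < e" for a b
  proof -
    have "continuous_on U (\<lambda>x. ?D x a b)"
      by (intro smooth_on_imp_continuous_on smooth_on_frechet_derivative f)
    then have "isCont (\<lambda>x. ?D x a b) p"
      using U continuous_on_eq_continuous_at by blast
    then show ?thesis
      using e unfolding continuous_at_eps_delta by (simp add: dist_real_def)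
  qed
  then obtain d1 d2 where d: "d1 > 0" "d2 > 0"
    and d1: "\<And>x. dist x p < d1 \<Longrightarrow> \<bar>?D x u v - ?D p u v\<bar> < e"
    and d2: "\<And>x. dist x p < d2 \<Longrightarrow> \<bar>?D x v u - ?D p v u\<bar> < e"
    by metis
  obtain d3 where d3: "d3 > 0" "\<And>x. dist x p < d3 \<Longrightarrow> x \<in> U"
    using U by (metis open_dist)
  define d where "d = min d1 (min d2 d3)"
  \<comment> \<open>With this \<open>h\<close> the parallelogram spanned by
    \<open>h *\<^sub>R u\<close> and \<open>h *\<^sub>R v\<close> at \<open>p\<close> stays within
    distance \<open>d\<close>; the summand 1 covers \<open>u = v = 0\<close>.\<close>
  define h where "h = d / (norm u + norm v + 1)"
  have pos: "norm u + norm v + 1 > 0" by (simp add: add_nonneg_pos)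
  have h: "h > 0" using d d3 pos by (simp add: h_def d_def)
  have near: "dist (p + s *\<^sub>R u + t *\<^sub>R v) p < d" if "0 \<le> s" "s \<le> h" "0 \<le> t" "t \<le> h" for s t
  proof -
    have "dist (p + s *\<^sub>R u + t *\<^sub>R v) p = norm (s *\<^sub>R u + t *\<^sub>R v)"
      by (simp add: dist_norm)
    also have "\<dots> \<le> s * norm u + t * norm v"
      using norm_triangle_ineq[of "s *\<^sub>R u" "t *\<^sub>R v"] that by simp
    also have "\<dots> \<le> h * norm u + h * norm v"
      using that by (intro add_mono mult_right_mono) auto
    also have "\<dots> < h * (norm u + norm v + 1)" using h by (simp add: algebra_simps)
    also have "\<dots> = d" using pos by (simp add: h_def)
    finally show ?thesis .
  qed
  have inU: "p + s *\<^sub>R u + t *\<^sub>R v \<in> U" "p + t *\<^sub>R v + s *\<^sub>R u \<in> U"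
    if "0 \<le> s" "s \<le> h" "0 \<le> t" "t \<le> h" for s t
    using near[OF that] d3(2)[of "p + s *\<^sub>R u + t *\<^sub>R v"]
    by (simp_all add: d_def add.assoc add.commute[of "t *\<^sub>R v"])
  obtain s t where 1: "0 \<le> s" "s \<le> h" "0 \<le> t" "t \<le> h"
    "f (p + h *\<^sub>R u + h *\<^sub>R v) - f (p + h *\<^sub>R u) - f (p + h *\<^sub>R v) + f p
      = h * h * ?D (p + s *\<^sub>R u + t *\<^sub>R v) v u"
    using second_difference_mean_value[OF f h inU(1)] by blast
  obtain s' t' where 2: "0 \<le> s'" "s' \<le> h" "0 \<le> t'" "t' \<le> h"
    "f (p + h *\<^sub>R v + h *\<^sub>R u) - f (p + h *\<^sub>R v) - f (p + h *\<^sub>R u) + f p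
      = h * h * ?D (p + s' *\<^sub>R v + t' *\<^sub>R u) u v"
    using second_difference_mean_value[OF f h inU(2)] by blast
  have "h * h * ?D (p + s *\<^sub>R u + t *\<^sub>R v) v u = h * h * ?D (p + t' *\<^sub>R u + s' *\<^sub>R v) u v"
    using 1(5) 2(5) by (simp add: algebra_simps)
  then have "?D (p + s *\<^sub>R u + t *\<^sub>R v) v u = ?D (p + t' *\<^sub>R u + s' *\<^sub>R v) u v"
    using h by simp
  moreover have "\<bar>?D (p + s *\<^sub>R u + t *\<^sub>R v) v u - ?D p v u\<bar> < e"
    using near[OF 1(1-4)] by (intro d2) (simp add: d_def)
  moreover have "\<bar>?D (p + t' *\<^sub>R u + s' *\<^sub>R v) u v - ?D p u v\<bar> < e"
    using near[OF 2(3,4,1,2)] by (intro d1) (simp add: d_def)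
  ultimately show False unfolding e_def by argo
qed

section \<open>Hermitian forms on \<open>\<complex>\<^sup>2\<close>\<close>

text \<open>The complex Hessian frozen at one point, which separates the linear algebra from the
  derivatives.\<close>

definition sesq :: "(2 \<Rightarrow> 2 \<Rightarrow> complex) \<Rightarrow> complex^2 \<Rightarrow> complex^2 \<Rightarrow> complex" where
  "sesq h A B = (\<Sum>j\<in>UNIV. \<Sum>k\<in>UNIV. h j k * A $ j * cnj (B $ k))"

lemma sesq_scaleR: "sesq h (a *\<^sub>R A) (b *\<^sub>R B) = of_real (a * b) * sesq h A B"
  by (simp add: sesq_def sum_2 scaleR_conv_of_real[where 'a = complex] algebra_simps)

lemma sesq_combination:
  "sesq h (a *s A + b *s B) (a *s A + b *s B)
    = of_real ((cmod a)\<^sup>2) * sesq h A A + a * cnj b * sesq h A B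
      + cnj a * b * sesq h B A + of_real ((cmod b)\<^sup>2) * sesq h B B"
  unfolding complex_norm_square by (simp add: sesq_def sum_2 algebra_simps)

lemma sesq_commute:
  assumes "\<And>j k. h k j = cnj (h j k)"
  shows "sesq h B A = cnj (sesq h A B)"
  by (simp add: sesq_def sum_2 assms[of 1 1, symmetric] assms[of 1 2, symmetric]
      assms[of 2 1, symmetric] assms[of 2 2, symmetric] algebra_simps)

lemma complex_hessian_eq_sesq:
  "complex_hessian f A B p = sesq (\<lambda>j k. d_z j (d_zbar k (cplx f)) p) (A p) (B p)"
  by (simp add: complex_hessian_def sesq_def)

text \<open>Hermitian symmetry of \<open>h\<close> follows by polarization from the reality of the quadratic form.\<close>

lemma sesq_Cauchy_Schwarz:
  assumes pos: "\<And>V. sesq h V V \<in> \<real>\<^sub>\<ge>\<^sub>0"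
  shows "(cmod (sesq h A B))\<^sup>2 \<le> cmod (sesq h A A) * cmod (sesq h B B)"
proof -
  define z where "z = sesq h A B"
  obtain a b where a: "sesq h A A = of_real a" "a \<ge> 0" and b: "sesq h B B = of_real b" "b \<ge> 0"
    using pos[of A] pos[of B] by (auto elim!: nonneg_Reals_cases)
  have expand: "of_real a + cnj t * z + t * sesq h B A + of_real ((cmod t)\<^sup>2) * of_real b \<in> \<real>\<^sub>\<ge>\<^sub>0" for t
    using pos[of "1 *s A + t *s B"] unfolding sesq_combination by (simp add: a b z_def)
  have "sesq h B A = cnj z"
    \<comment> \<open>Reality of the form at \<open>t = 1\<close> makes the imaginary parts of the
      two mixed terms opposite; at \<open>t = \<i>\<close> it makes their real parts equal.\<close>
    using expand[of 1] expand[of \<i>] by (simp add: complex_eq_iff complex_nonneg_Reals_iff)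
  note expand = expand[unfolded this]
  have quad: "a - 2 * s * (cmod z)\<^sup>2 + s\<^sup>2 * (cmod z)\<^sup>2 * b \<ge> 0" for s :: real
  proof -
    \<comment> \<open>A real multiple of \<open>z\<close> makes both mixed terms real and equal,
      leaving a real quadratic polynomial in \<open>s\<close>.\<close>
    define t where "t = - of_real s * z"
    have "cnj t * z = - of_real (s * (cmod z)\<^sup>2)" "t * cnj z = - of_real (s * (cmod z)\<^sup>2)"
      unfolding of_real_mult complex_norm_square by (simp_all add: t_def)
    moreover have "(cmod t)\<^sup>2 = s\<^sup>2 * (cmod z)\<^sup>2"
      by (simp add: t_def norm_mult power_mult_distrib)
    ultimately have "of_real a + cnj t * z + t * cnj z + of_real ((cmod t)\<^sup>2) * of_real b
        = complex_of_real (a - 2 * s * (cmod z)\<^sup>2 + s\<^sup>2 * (cmod z)\<^sup>2 * b)"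
      by simp
    then show ?thesis using expand[of t] by (simp only: nonneg_Reals_of_real_iff)
  qed
  have "(cmod z)\<^sup>2 \<le> a * b"
  proof (cases "b = 0")
    case True
    have "z = 0"
    proof (rule ccontr)
      assume "z \<noteq> 0"
      \<comment> \<open>With \<open>b = 0\<close> the polynomial is affine in \<open>s\<close>, and
        at this \<open>s\<close> its value is -1.\<close>
      then show False using quad[of "(a + 1) / (2 * (cmod z)\<^sup>2)"] True by (simp add: field_simps)
    qed
    then show ?thesis using a b by simp
  next
    case False
    then show ?thesis
      \<comment> \<open>The polynomial is minimized at \<open>s = 1 / b\<close>, where it equals
        \<open>a - (cmod z)\<^sup>2 / b\<close>.\<close>
      using quad[of "1 / b"] b by (simp add: field_simps power2_eq_square)
  qed
  then show ?thesis using a b by (simp add: z_def)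
qed

text \<open>The two mixed terms are conjugate, so their sum is at least
  \<open>- 2 * cmod a * cmod b * cmod (sesq h A B)\<close>. What remains is a real quadratic form in
  the moduli of \<open>a\<close> and \<open>b\<close>, controlled by its discriminant. It is applied
  with \<open>A\<close>, \<open>B\<close> the values of \<open>L\<close>, \<open>N\<close> at a
  point and \<open>c\<close> the weight gained from the square of the defining function.\<close>

lemma sesq_combination_nonneg:
  assumes herm: "\<And>j k. h k j = cnj (h j k)"
    and AA: "sesq h A A \<in> \<real>\<^sub>\<ge>\<^sub>0"
    and AB: "(cmod (sesq h A B))\<^sup>2 \<le> C * cmod (sesq h A A)"
    and C: "C > 0" "C \<le> Re (sesq h B B) + c"
  shows "sesq h (a *s A + b *s B) (a *s A + b *s B) + of_real (c * (cmod b)\<^sup>2) \<in> \<real>\<^sub>\<ge>\<^sub>0"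
proof -
  define z l n x y where "z = sesq h A B" and "l = cmod (sesq h A A)" and "n = Re (sesq h B B)"
    and "x = cmod a" and "y = cmod b"
  have A: "sesq h A A = of_real l"
    using AA by (auto simp: l_def elim!: nonneg_Reals_cases)
  have BA: "sesq h B A = cnj z" unfolding z_def by (rule sesq_commute[OF herm])
  have "Im (sesq h B B) = 0" using arg_cong[OF sesq_commute[where h = h and A = B and B = B, OF herm], of Im] by simp
  then have B: "sesq h B B = of_real n" by (simp add: n_def complex_eq_iff)
  have "Re (a * cnj b * z) \<ge> - (x * y * cmod z)"
    using abs_Re_le_cmod[of "a * cnj b * z"] by (simp add: norm_mult x_def y_def del: times_complex.sel)
  moreover have "x\<^sup>2 * l - 2 * (x * y * cmod z) + y\<^sup>2 * C \<ge> 0"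
  proof -
    \<comment> \<open>Multiplying by \<open>C > 0\<close> completes the square; the coefficient of
      \<open>x\<^sup>2\<close> left over is nonnegative by the assumption on
      \<open>sesq h A B\<close>.\<close>
    have "C * (x\<^sup>2 * l - 2 * (x * y * cmod z) + y\<^sup>2 * C)
        = (C * l - (cmod z)\<^sup>2) * x\<^sup>2 + (cmod z * x - C * y)\<^sup>2"
      by (simp add: power2_eq_square algebra_simps)
    also have "\<dots> \<ge> 0" using AB by (simp add: z_def l_def)
    finally show ?thesis using C by (simp add: zero_le_mult_iff)
  qed
  moreover have "y\<^sup>2 * C \<le> y\<^sup>2 * (n + c)"
    using C by (intro mult_left_mono) (auto simp: n_def)
  ultimately have "0 \<le> x\<^sup>2 * l + 2 * Re (a * cnj b * z) + y\<^sup>2 * n + c * y\<^sup>2"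
    by (simp add: distrib_left mult.commute[of c] del: times_complex.sel)
  moreover have "sesq h (a *s A + b *s B) (a *s A + b *s B) + of_real (c * (cmod b)\<^sup>2)
      = of_real (x\<^sup>2 * l + 2 * Re (a * cnj b * z) + y\<^sup>2 * n + c * y\<^sup>2)"
    unfolding sesq_combination A BA B z_def[symmetric] x_def[symmetric] y_def[symmetric]
    by (simp add: complex_eq_iff algebra_simps)
  ultimately show ?thesis by (simp only: nonneg_Reals_of_real_iff)
qed

section \<open>Wirtinger derivatives of real functions\<close>

lemma frechet_derivative_cplx:
  assumes "r differentiable (at p)"
  shows "frechet_derivative (cplx r) (at p) v = of_real (frechet_derivative r (at p) v)"
proof -
  have "(cplx r has_derivative (\<lambda>v. of_real (frechet_derivative r (at p) v))) (at p)"
    using assms by (intro has_derivative_of_real) (simp add: frechet_derivative_works)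
  then show ?thesis by (metis frechet_derivative_at)
qed

lemma d_z_cplx:
  assumes "r differentiable (at p)"
  shows "d_z j (cplx r) p = (of_real (frechet_derivative r (at p) (axis j 1))
    - \<i> * of_real (frechet_derivative r (at p) (axis j \<i>))) / 2"
  by (simp add: d_z_def frechet_derivative_cplx assms)

lemma d_zbar_cplx:
  assumes "r differentiable (at p)"
  shows "d_zbar j (cplx r) p = (of_real (frechet_derivative r (at p) (axis j 1))
    + \<i> * of_real (frechet_derivative r (at p) (axis j \<i>))) / 2"
  by (simp add: d_zbar_def frechet_derivative_cplx assms)

lemma d_zbar_cplx_cnj: "r differentiable (at p) \<Longrightarrow> d_zbar j (cplx r) p = cnj (d_z j (cplx r) p)"
  by (simp add: d_z_cplx d_zbar_cplx complex_eq_iff)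

lemma smooth_on_differentiable: "smooth_on U f \<Longrightarrow> x \<in> U \<Longrightarrow> f differentiable (at x)"
  using smooth_on_has_derivative differentiableI by blast

text \<open>Through this formula Hermitian symmetry, continuity and the effect of
  \<open>add_square\<close> on the Hessian all reduce to real second derivatives.\<close>

lemma d_z_d_zbar_cplx:
  assumes U: "open U" "p \<in> U" and r: "smooth_on U r"
  shows "d_z j (d_zbar k (cplx r)) p =
    (of_real (second_derivative r p (axis j 1) (axis k 1) + second_derivative r p (axis j \<i>) (axis k \<i>))
     + \<i> * of_real (second_derivative r p (axis j 1) (axis k \<i>) - second_derivative r p (axis j \<i>) (axis k 1))) / 4"
proof -
  have D: "((\<lambda>x. frechet_derivative r (at x) v) has_derivative (\<lambda>u. second_derivative r p u v)) (at p)" for v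
    by (rule smooth_on_has_derivative[OF smooth_on_frechet_derivative[OF r] U(2)])
  have "((\<lambda>x. (of_real (frechet_derivative r (at x) (axis k 1))
        + \<i> * of_real (frechet_derivative r (at x) (axis k \<i>))) / 2) has_derivative
      (\<lambda>u. (of_real (second_derivative r p u (axis k 1)) + \<i> * of_real (second_derivative r p u (axis k \<i>))) / 2))
      (at p)"
    by (auto intro!: derivative_eq_intros D)
  then have "(d_zbar k (cplx r) has_derivative
      (\<lambda>u. (of_real (second_derivative r p u (axis k 1)) + \<i> * of_real (second_derivative r p u (axis k \<i>))) / 2))
      (at p)"
    by (rule has_derivative_transform_within_open[OF _ U])
      (simp add: d_zbar_cplx smooth_on_differentiable[OF r])
  from frechet_derivative_at[OF this, symmetric] show ?thesis
    by (simp add: d_z_def field_simps)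
qed

text \<open>By symmetry of real second derivatives, exchanging \<open>j\<close> and \<open>k\<close>
  fixes the real part and changes the sign of the imaginary part.\<close>

lemma d_z_d_zbar_hermitian:
  assumes "open U" "p \<in> U" "smooth_on U r"
  shows "d_z k (d_zbar j (cplx r)) p = cnj (d_z j (d_zbar k (cplx r)) p)"
  by (simp add: d_z_d_zbar_cplx[OF assms] complex_eq_iff
      second_derivative_symmetric[OF assms(3,1,2), of "axis k _" "axis j _"])

lemma continuous_on_d_z:
  assumes "open U" "smooth_on U r"
  shows "continuous_on U (d_z j (cplx r))" "continuous_on U (d_zbar j (cplx r))"
proof -
  have "continuous_on U (\<lambda>x. frechet_derivative r (at x) v)" for v
    by (intro smooth_on_imp_continuous_on smooth_on_frechet_derivative assms)
  then show "continuous_on U (d_z j (cplx r))" "continuous_on U (d_zbar j (cplx r))"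
    by (auto simp: d_z_cplx d_zbar_cplx smooth_on_differentiable[OF assms(2)] cong: continuous_on_cong
        intro!: continuous_intros)
qed

lemma continuous_on_d_z_d_zbar:
  assumes "open U" "smooth_on U r"
  shows "continuous_on U (d_z j (d_zbar k (cplx r)))"
proof -
  have "continuous_on U (\<lambda>x. second_derivative r x u v)" for u v
    by (intro smooth_on_imp_continuous_on smooth_on_frechet_derivative assms)
  then show ?thesis
    by (auto simp: d_z_d_zbar_cplx[OF assms(1) _ assms(2)] cong: continuous_on_cong
        intro!: continuous_intros)
qed

text \<open>For real \<open>r\<close>, vanishing of both \<open>d_z\<close> derivatives kills the
  four real partials, and their directions span the space over the reals. Hence the normalization of
  \<open>L\<close> and \<open>N\<close> never divides by zero on the boundary.\<close>

lemma grad_norm_eq_0_imp: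
  assumes "r differentiable (at p)" and "grad_norm r p = 0"
  shows "frechet_derivative r (at p) = (\<lambda>v. 0)"
proof
  fix v :: "complex^2"
  let ?D = "frechet_derivative r (at p)"
  have "d_z 1 (cplx r) p = 0" "d_z 2 (cplx r) p = 0"
    using assms(2) by (simp_all add: grad_norm_def add_nonneg_eq_0_iff)
  then have zero: "?D (axis 1 1) = 0" "?D (axis 1 \<i>) = 0" "?D (axis 2 1) = 0" "?D (axis 2 \<i>) = 0"
    using assms(1) by (simp_all add: d_z_cplx complex_eq_iff)
  have "v = Re (v $ 1) *\<^sub>R axis 1 1 + Im (v $ 1) *\<^sub>R axis 1 \<i>
      + Re (v $ 2) *\<^sub>R axis 2 1 + Im (v $ 2) *\<^sub>R axis 2 \<i>"
    by (simp add: vec_eq_iff forall_2 axis_def complex_eq_iff)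
  then have "?D v = ?D (Re (v $ 1) *\<^sub>R axis 1 1 + Im (v $ 1) *\<^sub>R axis 1 \<i>
      + Re (v $ 2) *\<^sub>R axis 2 1 + Im (v $ 2) *\<^sub>R axis 2 \<i>)"
    by simp
  also have "\<dots> = 0"
    using linear_frechet_derivative[OF assms(1)] by (simp add: linear_add linear_cmul zero)
  finally show "?D v = 0" .
qed

text \<open>Supplies the bounds on compact pieces of the boundary from which the constant of the
  estimate and the weight \<open>M\<close> are drawn.\<close>

lemma continuous_on_hessian_N:
  assumes "open U" "smooth_on U r" "S \<subseteq> U" "\<And>p. p \<in> S \<Longrightarrow> grad_norm r p \<noteq> 0"
  shows "continuous_on S (grad_norm r)"
    and "continuous_on S (complex_hessian r (N_field r) (N_field r))"
proof -
  note c = continuous_on_subset[OF continuous_on_d_z(1)[OF assms(1,2)] assms(3)]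
    continuous_on_subset[OF continuous_on_d_z(2)[OF assms(1,2)] assms(3)]
    continuous_on_subset[OF continuous_on_d_z_d_zbar[OF assms(1,2)] assms(3)]
  show g: "continuous_on S (grad_norm r)"
    unfolding grad_norm_def by (intro continuous_intros c)
  show "continuous_on S (complex_hessian r (N_field r) (N_field r))"
    unfolding complex_hessian_def N_field_def
    by (auto simp: sum_2 assms(4) intro!: continuous_intros c g)
qed

section \<open>Local defining functions\<close>

lemma local_defining_functionD:
  assumes "local_defining_function \<Omega> q U r"
  shows "open U" "smooth_on U r" "q \<in> U" "q \<in> frontier \<Omega>" "\<Omega> \<inter> U = {p \<in> U. r p < 0}"
    and "p \<in> frontier \<Omega> \<inter> U \<Longrightarrow> grad_norm r p \<noteq> 0"
  using assms grad_norm_eq_0_imp smooth_on_differentiable unfolding local_defining_function_def by blast+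

lemma local_defining_function_subset:
  assumes "local_defining_function \<Omega> q U r" and "open W" "q \<in> W" "W \<subseteq> U"
  shows "local_defining_function \<Omega> q W r"
  using assms smooth_on_subset[of U r W] unfolding local_defining_function_def by blast

text \<open>A frontier point lies outside the open \<open>\<Omega>\<close>, so \<open>r\<close> is
  not negative there; a positive value would persist on a neighborhood, which meets
  \<open>\<Omega>\<close>, where \<open>r < 0\<close>.\<close>

lemma local_defining_function_eq_0:
  assumes "open \<Omega>" and r: "local_defining_function \<Omega> q U r" and p: "p \<in> frontier \<Omega> \<inter> U"
  shows "r p = 0"
proof (rule antisym)
  note D = local_defining_functionD[OF r]
  have "p \<notin> \<Omega>" using p \<open>open \<Omega>\<close> by (simp add: frontier_def interior_open)
  then show "0 \<le> r p" using D(5) p by force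
  show "r p \<le> 0"
  proof (rule ccontr)
    assume "\<not> r p \<le> 0"
    have "open {x \<in> U. r x \<in> {0<..}}"
      using continuous_open_preimage[OF smooth_on_imp_continuous_on[OF D(2)] D(1) open_greaterThan]
      by (simp add: vimage_def Int_def)
    moreover have "p \<in> {x \<in> U. r x \<in> {0<..}}" using p \<open>\<not> r p \<le> 0\<close> by simp
    moreover have "p \<in> closure \<Omega>" using p by (simp add: frontier_def)
    ultimately obtain x where "x \<in> \<Omega>" "x \<in> U" "r x > 0"
      by (auto simp: closure_iff_nhds_not_empty)
    then show False using D(5) by force
  qed
qed

text \<open>Pseudoconvexity is tested on fields smooth on all of \<open>U\<close>, whereas the
  gradient may vanish off the boundary. Hence the unnormalized multiple \<open>A\<close> of
  \<open>L\<close> is used, and the value is rescaled by a square at the end.\<close>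

lemma hessian_L_L_nonneg:
  assumes "pseudoconvex \<Omega>" and r: "local_defining_function \<Omega> q U r" and p: "p \<in> frontier \<Omega> \<inter> U"
  shows "complex_hessian r (L_field r) (L_field r) p \<in> \<real>\<^sub>\<ge>\<^sub>0"
proof -
  note D = local_defining_functionD[OF r]
  define A :: vfield10 where "A = (\<lambda>p. vector [d_z 2 (cplx r) p, - d_z 1 (cplx r) p])"
  have "smooth_on U (\<lambda>p. frechet_derivative r (at p) v *\<^sub>R w)" for v and w :: "complex^2"
    by (rule smooth_on_bounded_linear[OF D(1) bounded_linear_scaleR_left smooth_on_frechet_derivative[OF D(2)]])
  \<comment> \<open>\<open>A\<close> as a combination of constant vectors with real partial
    derivatives of \<open>r\<close> as coefficients.\<close>
  then have "smooth_on U (\<lambda>p. frechet_derivative r (at p) (axis 2 1) *\<^sub>R vector [1 / 2, 0]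
      + frechet_derivative r (at p) (axis 2 \<i>) *\<^sub>R vector [- \<i> / 2, 0]
      + frechet_derivative r (at p) (axis 1 1) *\<^sub>R vector [0, - 1 / 2]
      + frechet_derivative r (at p) (axis 1 \<i>) *\<^sub>R vector [0, \<i> / 2] :: complex^2)"
    by (intro smooth_on_add D(1))
  then have "smooth_on U A"
  proof (rule smooth_on_cong[OF D(1)])
    fix x assume "x \<in> U"
    note d = d_z_cplx[OF smooth_on_differentiable[OF D(2) this]]
    show "frechet_derivative r (at x) (axis 2 1) *\<^sub>R vector [1 / 2, 0]
      + frechet_derivative r (at x) (axis 2 \<i>) *\<^sub>R vector [- \<i> / 2, 0]
      + frechet_derivative r (at x) (axis 1 1) *\<^sub>R vector [0, - 1 / 2]
      + frechet_derivative r (at x) (axis 1 \<i>) *\<^sub>R vector [0, \<i> / 2] = A x"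
      by (simp add: A_def vec_eq_iff forall_2 vector_2 d complex_eq_iff)
  qed
  moreover have "vf_apply A r x = 0" for x
    by (simp add: vf_apply_def A_def sum_2 vector_2)
  ultimately have "complex_hessian r A A p \<in> \<real>\<^sub>\<ge>\<^sub>0"
    using assms(1) r p unfolding pseudoconvex_def by blast
  moreover have "L_field r p = (1 / grad_norm r p) *\<^sub>R A p"
    by (simp add: L_field_def A_def)
  ultimately show ?thesis
    unfolding complex_hessian_eq_sesq
    by (simp only: sesq_scaleR nonneg_Reals_mult_I nonneg_Reals_of_real_iff zero_le_square)
qed

text \<open>\<open>L\<close> and \<open>N\<close> form a unitary frame. The coefficient of
  \<open>N\<close> is kept explicit because it is \<open>V r\<close> divided by the gradient norm,
  which links it to the extra Hessian term of \<open>add_square\<close>.\<close>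

lemma L_N_decomposition:
  assumes "r differentiable (at p)" and "grad_norm r p \<noteq> 0"
  shows "\<exists>a. V = a *s L_field r p
    + (V $ 1 * d_z 1 (cplx r) p + V $ 2 * d_z 2 (cplx r) p) / of_real (grad_norm r p) *s N_field r p"
proof -
  define x y g where "x = d_z 1 (cplx r) p" and "y = d_z 2 (cplx r) p" and "g = complex_of_real (grad_norm r p)"
  have "(grad_norm r p)\<^sup>2 = (cmod x)\<^sup>2 + (cmod y)\<^sup>2"
    by (simp add: grad_norm_def x_def y_def)
  then have g2: "g * g = x * cnj x + y * cnj y"
    unfolding g_def complex_norm_square[symmetric] by (metis of_real_add of_real_mult power2_eq_square)
  have g0: "g \<noteq> 0" using assms(2) by (simp add: g_def)
  have L: "L_field r p $ 1 = y / g" "L_field r p $ 2 = - x / g"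
    by (simp_all add: L_field_def vector_2 x_def y_def g_def scaleR_conv_of_real[where 'a = complex])
  have N: "N_field r p $ 1 = cnj x / g" "N_field r p $ 2 = cnj y / g"
    by (simp_all add: N_field_def vector_2 d_zbar_cplx_cnj[OF assms(1)] x_def y_def g_def
        scaleR_conv_of_real[where 'a = complex])
  \<comment> \<open>The coefficients are the Hermitian products of \<open>V\<close> with
    \<open>L\<close> and \<open>N\<close>; the terms in the other component of \<open>V\<close>
    cancel.\<close>
  have eqs: "(V $ 1 * cnj y - V $ 2 * cnj x) / g * (y / g) + (V $ 1 * x + V $ 2 * y) / g * (cnj x / g)
      = V $ 1 * (x * cnj x + y * cnj y) / (g * g)"
    "(V $ 1 * cnj y - V $ 2 * cnj x) / g * (- x / g) + (V $ 1 * x + V $ 2 * y) / g * (cnj y / g)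
      = V $ 2 * (x * cnj x + y * cnj y) / (g * g)"
    by (simp_all add: add_divide_distrib diff_divide_distrib algebra_simps)
  have "V = (V $ 1 * cnj y - V $ 2 * cnj x) / g *s L_field r p + (V $ 1 * x + V $ 2 * y) / g *s N_field r p"
    using g0 by (simp only: vec_eq_iff forall_2 vector_add_component vector_smult_component L N eqs g2[symmetric]) simp
  then show ?thesis unfolding x_def y_def g_def by blast
qed

section \<open>From plurisubharmonicity to the estimate\<close>

lemma psh_on_boundary_imp_hessian_estimate:
  assumes r: "local_defining_function \<Omega> q U r" and psh: "psh_on_boundary \<Omega> U r"
  shows "hessian_estimate \<Omega> U r"
  unfolding hessian_estimate_def bigO_loc_def
proof (intro allI impI, elim conjE)
  fix K assume K: "compact (closure K)" "closure K \<subseteq> frontier \<Omega> \<inter> U"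
  note D = local_defining_functionD[OF r]
  let ?N = "complex_hessian r (N_field r) (N_field r)"
  have "continuous_on (closure K) ?N"
    by (rule continuous_on_hessian_N(2)[OF D(1,2)]) (use K D(6) in auto)
  then have "bounded (?N ` closure K)"
    using K compact_continuous_image compact_imp_bounded by blast
  then obtain C where C: "C > 0" "\<And>p. p \<in> closure K \<Longrightarrow> cmod (?N p) \<le> C"
    by (auto simp: bounded_pos)
  have "(cmod (complex_hessian r (L_field r) (N_field r) p))\<^sup>2
      \<le> C * cmod (complex_hessian r (L_field r) (L_field r) p)" if "p \<in> K" for p
  proof -
    have p: "p \<in> closure K" using that closure_subset by blast
    \<comment> \<open>Constant fields are smooth and realize every vector at
      \<open>p\<close>.\<close>
    have "sesq (\<lambda>j k. d_z j (d_zbar k (cplx r)) p) V V \<in> \<real>\<^sub>\<ge>\<^sub>0" for V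
      using psh smooth_on_const[of U V] K p unfolding psh_on_boundary_def complex_hessian_eq_sesq by blast
    from sesq_Cauchy_Schwarz[OF this, of "L_field r p" "N_field r p"]
    have "(cmod (complex_hessian r (L_field r) (N_field r) p))\<^sup>2
        \<le> cmod (complex_hessian r (L_field r) (L_field r) p) * cmod (?N p)"
      by (simp add: complex_hessian_eq_sesq)
    also have "\<dots> \<le> cmod (complex_hessian r (L_field r) (L_field r) p) * C"
      using C(2)[OF p] by (intro mult_left_mono) auto
    finally show ?thesis by (simp add: mult.commute)
  qed
  then show "\<exists>C>0. \<forall>x\<in>K. norm ((cmod (complex_hessian r (L_field r) (N_field r) x))\<^sup>2)
      \<le> C * cmod (complex_hessian r (L_field r) (L_field r) x)"
    using C(1) by auto
qed

section \<open>The defining function \<open>\<rho> + M \<rho>\<^sup>2\<close>\<close>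

text \<open>The square is written as a product so that the bilinear rule gives its
  smoothness.\<close>

definition add_square :: "real \<Rightarrow> (complex^2 \<Rightarrow> real) \<Rightarrow> complex^2 \<Rightarrow> real" where
  "add_square M \<rho> x = \<rho> x + M * (\<rho> x * \<rho> x)"

lemma smooth_on_add_square:
  assumes "open U" "smooth_on U \<rho>"
  shows "smooth_on U (add_square M \<rho>)"
proof -
  have "smooth_on U (\<lambda>x. \<rho> x + M * (\<rho> x * \<rho> x))"
    by (rule smooth_on_add[OF assms smooth_on_bounded_linear[OF assms(1) bounded_linear_mult_right
          smooth_on_bounded_bilinear[OF assms(1) bounded_bilinear_mult assms(2) assms(2)]]])
  then show ?thesis by (simp add: add_square_def[abs_def])
qed

lemma frechet_derivative_add_square:
  assumes "smooth_on U \<rho>" "p \<in> U"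
  shows "frechet_derivative (add_square M \<rho>) (at p)
    = (\<lambda>v. (1 + 2 * M * \<rho> p) * frechet_derivative \<rho> (at p) v)"
proof -
  have "(add_square M \<rho> has_derivative (\<lambda>v. (1 + 2 * M * \<rho> p) * frechet_derivative \<rho> (at p) v)) (at p)"
    unfolding add_square_def[abs_def]
    by (auto intro!: derivative_eq_intros smooth_on_has_derivative[OF assms] simp: algebra_simps)
  then show ?thesis by (metis frechet_derivative_at)
qed

text \<open>The factor \<open>1 + 2 * M * \<rho>\<close> in front of the first derivative equals 1
  where \<open>\<rho>\<close> vanishes, and its own derivative contributes the product of first
  derivatives.\<close>

lemma second_derivative_add_square:
  assumes U: "open U" "p \<in> U" and \<rho>: "smooth_on U \<rho>" "\<rho> p = 0"
  shows "second_derivative (add_square M \<rho>) p u v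
    = second_derivative \<rho> p u v + 2 * M * (frechet_derivative \<rho> (at p) u * frechet_derivative \<rho> (at p) v)"
proof -
  note D = smooth_on_has_derivative[OF \<rho>(1) U(2)]
    smooth_on_has_derivative[OF smooth_on_frechet_derivative[OF \<rho>(1), of v] U(2)]
  have "((\<lambda>x. (1 + 2 * M * \<rho> x) * frechet_derivative \<rho> (at x) v) has_derivative
      (\<lambda>u. second_derivative \<rho> p u v
        + 2 * M * (frechet_derivative \<rho> (at p) u * frechet_derivative \<rho> (at p) v))) (at p)"
    by (auto intro!: derivative_eq_intros D simp: \<rho>(2))
  then have "((\<lambda>x. frechet_derivative (add_square M \<rho>) (at x) v) has_derivative
      (\<lambda>u. second_derivative \<rho> p u v
        + 2 * M * (frechet_derivative \<rho> (at p) u * frechet_derivative \<rho> (at p) v))) (at p)"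
    by (rule has_derivative_transform_within_open[OF _ U])
      (simp add: frechet_derivative_add_square[OF \<rho>(1)])
  from frechet_derivative_at[OF this, symmetric] show ?thesis by simp
qed

text \<open>The Hessian matrix gains \<open>2 * M\<close> times the rank-one matrix built from the
  \<open>d_z\<close> derivatives of \<open>\<rho>\<close>, whose quadratic form is the squared
  modulus of \<open>V \<rho>\<close>.\<close>

lemma complex_hessian_add_square:
  assumes U: "open U" "p \<in> U" and \<rho>: "smooth_on U \<rho>" "\<rho> p = 0"
  shows "complex_hessian (add_square M \<rho>) V V p
    = complex_hessian \<rho> V V p + of_real (2 * M * (cmod (vf_apply V \<rho> p))\<^sup>2)"
proof -
  have "d_z j (d_zbar k (cplx (add_square M \<rho>))) p
      = d_z j (d_zbar k (cplx \<rho>)) p + 2 * of_real M * d_z j (cplx \<rho>) p * cnj (d_z k (cplx \<rho>) p)" for j k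
    unfolding d_z_d_zbar_cplx[OF U \<rho>(1)] d_z_d_zbar_cplx[OF U smooth_on_add_square[OF U(1) \<rho>(1)]]
      second_derivative_add_square[OF U \<rho>] d_z_cplx[OF smooth_on_differentiable[OF \<rho>(1) U(2)]]
    by (simp add: complex_eq_iff field_simps)
  moreover have "complex_of_real (2 * M * (cmod (vf_apply V \<rho> p))\<^sup>2)
      = 2 * of_real M * (vf_apply V \<rho> p * cnj (vf_apply V \<rho> p))"
    unfolding complex_norm_square[symmetric] by simp
  ultimately show ?thesis
    by (simp add: complex_hessian_def vf_apply_def sum_2 algebra_simps)
qed

lemma complex_hessian_add_square_nonneg:
  assumes U: "open U" "p \<in> U" and \<rho>: "smooth_on U \<rho>" "\<rho> p = 0" "grad_norm \<rho> p \<noteq> 0"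
    and LL: "complex_hessian \<rho> (L_field \<rho>) (L_field \<rho>) p \<in> \<real>\<^sub>\<ge>\<^sub>0"
    and LN: "(cmod (complex_hessian \<rho> (L_field \<rho>) (N_field \<rho>) p))\<^sup>2
      \<le> C * cmod (complex_hessian \<rho> (L_field \<rho>) (L_field \<rho>) p)"
    and C: "C > 0" "C \<le> Re (complex_hessian \<rho> (N_field \<rho>) (N_field \<rho>) p) + 2 * M * (grad_norm \<rho> p)\<^sup>2"
  shows "complex_hessian (add_square M \<rho>) V V p \<in> \<real>\<^sub>\<ge>\<^sub>0"
proof -
  define h where "h = (\<lambda>j k. d_z j (d_zbar k (cplx \<rho>)) p)"
  define b where "b = vf_apply V \<rho> p / of_real (grad_norm \<rho> p)"
  obtain a where V: "V p = a *s L_field \<rho> p + b *s N_field \<rho> p"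
    using L_N_decomposition[OF smooth_on_differentiable[OF \<rho>(1) U(2)] \<rho>(3), of "V p"]
    by (auto simp: b_def vf_apply_def sum_2)
  have "2 * M * (cmod (vf_apply V \<rho> p))\<^sup>2 = 2 * M * (grad_norm \<rho> p)\<^sup>2 * (cmod b)\<^sup>2"
    using \<rho>(3) by (simp add: b_def norm_divide power_divide)
  moreover have "sesq h (a *s L_field \<rho> p + b *s N_field \<rho> p) (a *s L_field \<rho> p + b *s N_field \<rho> p)
      + of_real (2 * M * (grad_norm \<rho> p)\<^sup>2 * (cmod b)\<^sup>2) \<in> \<real>\<^sub>\<ge>\<^sub>0"
  proof (rule sesq_combination_nonneg[OF _ _ _ C(1)])
    show "h k j = cnj (h j k)" for j k
      unfolding h_def by (rule d_z_d_zbar_hermitian[OF U \<rho>(1)])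
  qed (use LL LN C(2) in \<open>simp_all add: complex_hessian_eq_sesq h_def\<close>)
  ultimately show ?thesis
    unfolding complex_hessian_add_square[OF U \<rho>(1,2)]
    unfolding complex_hessian_eq_sesq h_def V by (simp only:)
qed

text \<open>\<open>add_square M \<rho>\<close> factors as \<open>\<rho> * (1 + M * \<rho>)\<close>:
  a positive second factor preserves the sign, and on the boundary, where \<open>\<rho> = 0\<close>,
  the differential is unchanged.\<close>

lemma local_defining_function_add_square:
  assumes \<Omega>: "open \<Omega>" and \<rho>: "local_defining_function \<Omega> q U \<rho>"
    and W: "open W" "q \<in> W" "W \<subseteq> U" and small: "\<And>x. x \<in> W \<Longrightarrow> 1 + M * \<rho> x > 0"
  shows "local_defining_function \<Omega> q W (add_square M \<rho>)"
proof -
  note D = local_defining_functionD[OF \<rho>]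
  have "add_square M \<rho> x < 0 \<longleftrightarrow> \<rho> x < 0" if "x \<in> W" for x
  proof -
    have "add_square M \<rho> x = \<rho> x * (1 + M * \<rho> x)" by (simp add: add_square_def algebra_simps)
    then show ?thesis using small[OF that] by (simp add: mult_less_0_iff)
  qed
  then have "\<Omega> \<inter> W = {x \<in> W. add_square M \<rho> x < 0}" using D(5) W(3) by blast
  moreover have "frechet_derivative (add_square M \<rho>) (at x) \<noteq> (\<lambda>v. 0)" if "x \<in> frontier \<Omega> \<inter> W" for x
  proof -
    have x: "x \<in> frontier \<Omega> \<inter> U" using that W(3) by blast
    have "frechet_derivative (add_square M \<rho>) (at x) = frechet_derivative \<rho> (at x)"
      using x by (simp add: frechet_derivative_add_square[OF D(2)]
          local_defining_function_eq_0[OF \<Omega> \<rho> x])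
    then show ?thesis using \<rho> x unfolding local_defining_function_def by metis
  qed
  ultimately show ?thesis
    unfolding local_defining_function_def
    using D(4) W smooth_on_subset[OF smooth_on_add_square[OF D(1,2)] W(3)] by blast
qed

section \<open>From the estimate to plurisubharmonicity\<close>

lemma hessian_estimate_imp_psh_on_boundary:
  assumes \<Omega>: "open \<Omega>" "pseudoconvex \<Omega>" and \<rho>: "local_defining_function \<Omega> q U \<rho>"
    and est: "hessian_estimate \<Omega> U \<rho>"
  shows "\<exists>W r. local_defining_function \<Omega> q W r \<and> psh_on_boundary \<Omega> W r"
proof -
  note D = local_defining_functionD[OF \<rho>]
  obtain e where e: "e > 0" "cball q e \<subseteq> U"
    using D(1,3) open_contains_cball by blast
  \<comment> \<open>A compact piece of the boundary on which the estimate has a single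
    constant.\<close>
  define K where "K = frontier \<Omega> \<inter> cball q e"
  have K: "compact K" "K \<subseteq> frontier \<Omega> \<inter> U"
    using e by (auto simp: K_def intro: closed_Int_compact)
  then have "compact (closure K) \<and> closure K \<subseteq> frontier \<Omega> \<inter> U"
    by (simp add: compact_imp_closed)
  with est obtain C where C: "C > 0" and "\<forall>p\<in>K. norm ((cmod (complex_hessian \<rho> (L_field \<rho>) (N_field \<rho>) p))\<^sup>2)
      \<le> C * cmod (complex_hessian \<rho> (L_field \<rho>) (L_field \<rho>) p)"
    unfolding hessian_estimate_def bigO_loc_def by blast
  then have LN: "(cmod (complex_hessian \<rho> (L_field \<rho>) (N_field \<rho>) p))\<^sup>2
      \<le> C * cmod (complex_hessian \<rho> (L_field \<rho>) (L_field \<rho>) p)" if "p \<in> K" for p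
    using that by simp
  \<comment> \<open>The condition relating \<open>C\<close>, \<open>H(N,N)\<close> and the gradient
    norm, solved for \<open>M\<close>: it holds at \<open>p\<close> once
    \<open>f p \<le> M\<close>.\<close>
  define f where "f = (\<lambda>p. (C - Re (complex_hessian \<rho> (N_field \<rho>) (N_field \<rho>) p)) / (2 * (grad_norm \<rho> p)\<^sup>2))"
  have g: "grad_norm \<rho> p \<noteq> 0" if "p \<in> K" for p
    using D(6) K(2) that by blast
  have "continuous_on K f"
    unfolding f_def using g K(2)
    by (intro continuous_intros continuous_on_hessian_N[OF D(1,2)]) auto
  then have "bounded (f ` K)"
    using K compact_continuous_image compact_imp_bounded by blast
  then obtain M where M: "M > 0" "\<And>p. p \<in> K \<Longrightarrow> \<bar>f p\<bar> \<le> M"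
    by (auto simp: bounded_pos)
  \<comment> \<open>The ball keeps boundary points of \<open>W\<close> inside \<open>K\<close>; the
    lower bound on \<open>\<rho>\<close> makes \<open>1 + M * \<rho>\<close> positive.\<close>
  define W where "W = ball q e \<inter> (U \<inter> \<rho> -` {- 1 / M<..})"
  have W: "open W" "W \<subseteq> U"
    using continuous_open_preimage[OF smooth_on_imp_continuous_on[OF D(2)] D(1) open_greaterThan]
    by (auto simp: W_def)
  have "\<rho> q = 0" using local_defining_function_eq_0[OF \<Omega>(1) \<rho>] D(3,4) by blast
  then have "q \<in> W" using D(3) e M(1) by (simp add: W_def)
  have "1 + M * \<rho> x > 0" if "x \<in> W" for x
    using that M(1) by (simp add: W_def field_simps)
  then have "local_defining_function \<Omega> q W (add_square M \<rho>)"
    by (rule local_defining_function_add_square[OF \<Omega>(1) \<rho> W(1) \<open>q \<in> W\<close> W(2)])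
  moreover have "psh_on_boundary \<Omega> W (add_square M \<rho>)"
    unfolding psh_on_boundary_def
  proof (intro allI impI ballI)
    fix V p assume "p \<in> frontier \<Omega> \<inter> W"
    then have p: "p \<in> K" "p \<in> frontier \<Omega> \<inter> U" "p \<in> U" by (auto simp: K_def W_def)
    have "f p \<le> M" using M(2)[OF p(1)] by simp
    then have le: "C \<le> Re (complex_hessian \<rho> (N_field \<rho>) (N_field \<rho>) p) + 2 * M * (grad_norm \<rho> p)\<^sup>2"
      using g[OF p(1)] by (simp add: f_def field_simps)
    show "complex_hessian (add_square M \<rho>) V V p \<in> \<real>\<^sub>\<ge>\<^sub>0"
      by (rule complex_hessian_add_square_nonneg[OF D(1) p(3) D(2) local_defining_function_eq_0[OF \<Omega>(1) \<rho> p(2)]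
            g[OF p(1)] hessian_L_L_nonneg[OF \<Omega>(2) \<rho> p(2)] LN[OF p(1)] C le])
  qed
  ultimately show ?thesis by blast
qed

theorem proposition5p2:
  fixes \<Omega> :: "(complex^2) set" and p\<^sub>0 :: "complex^2"
  assumes "open \<Omega>" and "connected \<Omega>"
    and "smoothly_bounded \<Omega>" and "pseudoconvex \<Omega>"
    and "p\<^sub>0 \<in> frontier \<Omega>"
  shows "((\<exists>U r. local_defining_function \<Omega> p\<^sub>0 U r \<and> psh_on_boundary_near \<Omega> p\<^sub>0 U r) \<longleftrightarrow>
          (\<exists>U \<rho>. local_defining_function \<Omega> p\<^sub>0 U \<rho> \<and> hessian_estimate \<Omega> U \<rho>)) \<and>
         (\<forall>U \<rho>. local_defining_function \<Omega> p\<^sub>0 U \<rho> \<and> psh_on_boundary \<Omega> U \<rho> \<longrightarrow>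
            hessian_estimate \<Omega> U \<rho>)"
proof (intro conjI iffI allI impI; elim exE conjE)
  fix U r assume r: "local_defining_function \<Omega> p\<^sub>0 U r" and "psh_on_boundary_near \<Omega> p\<^sub>0 U r"
  then obtain W where W: "open W" "p\<^sub>0 \<in> W" "W \<subseteq> U" "psh_on_boundary \<Omega> W r"
    unfolding psh_on_boundary_near_def by blast
  \<comment> \<open>Plurisubharmonicity is known only on \<open>W\<close>, so the domain of
    \<open>r\<close> is shrunk to \<open>W\<close> before the estimate is derived.\<close>
  have "local_defining_function \<Omega> p\<^sub>0 W r"
    by (rule local_defining_function_subset[OF r W(1-3)])
  with W(4) show "\<exists>U \<rho>. local_defining_function \<Omega> p\<^sub>0 U \<rho> \<and> hessian_estimate \<Omega> U \<rho>"
    using psh_on_boundary_imp_hessian_estimate by blast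
next
  fix U \<rho> assume "local_defining_function \<Omega> p\<^sub>0 U \<rho>" "hessian_estimate \<Omega> U \<rho>"
  from hessian_estimate_imp_psh_on_boundary[OF assms(1,4) this] obtain W r
    where r: "local_defining_function \<Omega> p\<^sub>0 W r" "psh_on_boundary \<Omega> W r" by blast
  then have "psh_on_boundary_near \<Omega> p\<^sub>0 W r"
    using local_defining_functionD(1,3)[OF r(1)] unfolding psh_on_boundary_near_def by blast
  with r(1) show "\<exists>U r. local_defining_function \<Omega> p\<^sub>0 U r \<and> psh_on_boundary_near \<Omega> p\<^sub>0 U r" by blast
next
  fix U \<rho> assume "local_defining_function \<Omega> p\<^sub>0 U \<rho>" "psh_on_boundary \<Omega> U \<rho>"
  then show "hessian_estimate \<Omega> U \<rho>" by (rule psh_on_boundary_imp_hessian_estimate)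
qed

end
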